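(* There are continuum many pairwise non-isomorphic epiRegular groups.
   Context: For a set $X$, $X^*$ denotes the set of all finite strings over $X$, including the empty string. For a group $G$ and $X\subseteq G$, and $w\in X^*$, $g\in G$, write $w=_G g$ if the product in $G$ of the letters of $w$ equals $g$. A group $G$ is epiRegular if there are a finite set $X\subseteq G$ generating $G$ as a monoid and a regular language $L\subseteq X^*$ such that no $w\in L$ satisfies $w=_G 1_G$, and for every $h\in G\setminus\{1_G\}$ there is $w_h\in L$ with $w_h=_G h$. *)

theory Defs
  imports Complex_Main "HOL-Library.Equipollence" "HOL-Algebra.Group"
begin

text \<open>
  A language over a finite alphabet \<open>X\<close> is regular if it is the set of words over \<open>X\<close> accepted by
  a complete deterministic finite automaton. States are natural numbers, which is no loss of
  generality because the state set \<open>Q\<close> is finite.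
\<close>

definition regular_language :: "'a set \<Rightarrow> 'a list set \<Rightarrow> bool" where
  "regular_language X L \<longleftrightarrow>
     (\<exists>(Q :: nat set) (\<delta> :: nat \<Rightarrow> 'a \<Rightarrow> nat) q0 F.
        finite Q \<and> q0 \<in> Q \<and> F \<subseteq> Q \<and>
        (\<forall>q\<in>Q. \<forall>x\<in>X. \<delta> q x \<in> Q) \<and>
        L = {w \<in> lists X. foldl \<delta> q0 w \<in> F})"

definition word_prod :: "('a, 'b) monoid_scheme \<Rightarrow> 'a list \<Rightarrow> 'a" where
  "word_prod G w = foldr (\<otimes>\<^bsub>G\<^esub>) w \<one>\<^bsub>G\<^esub>"

definition generates_as_monoid :: "('a, 'b) monoid_scheme \<Rightarrow> 'a set \<Rightarrow> bool" where
  "generates_as_monoid G X \<longleftrightarrow>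
     X \<subseteq> carrier G \<and> (\<forall>g\<in>carrier G. \<exists>w\<in>lists X. word_prod G w = g)"

text \<open>
  Since \<open>X\<close> below is finite, such a group is countable, hence isomorphic to one of type \<open>nat monoid\<close>
  (whose carrier may be any set of natural numbers).
\<close>

definition epiRegular :: "('a, 'b) monoid_scheme \<Rightarrow> bool" where
  "epiRegular G \<longleftrightarrow> group G \<and>
     (\<exists>X L. finite X \<and> generates_as_monoid G X \<and> L \<subseteq> lists X \<and> regular_language X L \<and>
        (\<forall>w\<in>L. word_prod G w \<noteq> \<one>\<^bsub>G\<^esub>) \<and>
        (\<forall>h\<in>carrier G - {\<one>\<^bsub>G\<^esub>}. \<exists>w\<in>L. word_prod G w = h))"

end

theory Submission
  imports Defs "HOL-Library.Countable_Set_Type" "HOL-Analysis.Continuum_Not_Denumerable"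
begin

text \<open>
  The groups are P. Hall's central extensions of the lamplighter group. Let \<open>N\<close> be generated by
  involutions \<open>a\<^sub>i\<close> (\<open>i \<in> \<int>\<close>) and a central involution \<open>z\<close>, where for \<open>i < j\<close> the lamps \<open>a\<^sub>i\<close> and
  \<open>a\<^sub>j\<close> commute if \<open>j - i \<notin> A\<close> and have commutator \<open>z\<close> if \<open>j - i \<in> A\<close>. Here \<open>A\<close> is an arbitrary set
  of positive integers. The relations are invariant under \<open>a\<^sub>i \<mapsto> a\<^bsub>i+1\<^esub>\<close>, so an infinite
  cyclic group \<open>\<langle>t\<rangle>\<close> acts on \<open>N\<close>, and the group \<open>G\<^sub>A = N \<rtimes> \<langle>t\<rangle>\<close> is generated by \<open>a\<^sub>0\<close>, \<open>t\<close> and \<open>z\<close>.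

  Each \<open>G\<^sub>A\<close> is epiRegular, by one automaton that does not depend on \<open>A\<close>. A nontrivial
  element of \<open>G\<^sub>A\<close> either has a lit lamp, or is a power of \<open>t\<close>, possibly times \<open>z\<close>. An element with a
  lit lamp is spelled by walking to its leftmost lamp, lighting it, sweeping to the right
  while lighting the other lamps, correcting the central coordinate by letters \<open>z\<close>, and walking to
  the final position; no lamp is ever switched off, because a lamp is touched only on the way
  to the right. Conversely, in every word of this shape the first lamp that is lit stays lit,
  so its value is nontrivial no matter what the central coordinate is; finitely many states
  suffice to recognise this shape. The values of the commutators, which depend on \<open>A\<close>, enter only into
  the central coordinate, which is why \<open>A\<close> may be arbitrary. The remaining elements are spelled
  by \<open>t\<^sup>n\<close> and \<open>z t\<^sup>n\<close>.

  The set \<open>A\<close> can be read off from the pair \<open>(a\<^sub>0, t)\<close>, because \<open>n \<in> A\<close> holds exactly when \<open>a\<^sub>0\<close> does not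
  commute with \<open>t\<^sup>n a\<^sub>0 t\<^bsup>-n\<^esup>\<close>. A countable group contains only countably many pairs, so each isomorphism
  class contains \<open>G\<^sub>A\<close> for at most countably many \<open>A\<close>. With the sets \<open>A\<close> indexed by the reals
  through Dedekind cuts, the isomorphism classes are therefore as many as the reals.
\<close>

section \<open>Regular languages and isomorphism invariance\<close>

lemma regular_languageI:
  fixes \<delta> :: "'s::finite \<Rightarrow> 'a \<Rightarrow> 's"
  shows "regular_language X {w \<in> lists X. foldl \<delta> q w \<in> F}"
proof -
  define \<delta>' where "\<delta>' = (\<lambda>k x. to_nat (\<delta> (from_nat k) x))"
  have fold: "foldl \<delta>' (to_nat p) w = to_nat (foldl \<delta> p w)" for p w
    by (induction w arbitrary: p) (simp_all add: \<delta>'_def)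
  have accept: "foldl \<delta>' (to_nat q) w \<in> to_nat ` F \<longleftrightarrow> foldl \<delta> q w \<in> F" for w
    unfolding fold by (simp add: inj_image_mem_iff)
  show ?thesis
    unfolding regular_language_def
    by (rule exI[of _ "range (to_nat :: 's \<Rightarrow> nat)"], rule exI[of _ \<delta>'],
        rule exI[of _ "to_nat q"], rule exI[of _ "to_nat ` F"])
       (auto simp: accept, simp add: \<delta>'_def)
qed

lemma regular_language_map:
  assumes "regular_language X L" "inj_on h X"
  shows "regular_language (h ` X) (map h ` L)"
proof -
  obtain Q \<delta> q0 F where A: "finite (Q :: nat set)" "q0 \<in> Q" "F \<subseteq> Q" "\<forall>q\<in>Q. \<forall>x\<in>X. \<delta> q x \<in> Q"
    and L: "L = {w \<in> lists X. foldl \<delta> q0 w \<in> F}"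
    using assms(1) unfolding regular_language_def by blast
  define \<delta>' where "\<delta>' = (\<lambda>q y. \<delta> q (inv_into X h y))"
  have fold: "foldl \<delta>' q (map h w) = foldl \<delta> q w" if "w \<in> lists X" for q w
    using that by (induction w arbitrary: q) (auto simp: \<delta>'_def assms(2))
  have "map h ` L = {w \<in> lists (h ` X). foldl \<delta>' q0 w \<in> F}"
  proof (intro equalityI subsetI)
    fix v assume "v \<in> map h ` L"
    then obtain w where w: "w \<in> lists X" "foldl \<delta> q0 w \<in> F" "v = map h w"
      unfolding L by blast
    then have "v \<in> lists (h ` X)" "foldl \<delta>' q0 v \<in> F" using fold[OF w(1)] by auto
    then show "v \<in> {w \<in> lists (h ` X). foldl \<delta>' q0 w \<in> F}" by blast
  next
    fix v assume "v \<in> {w \<in> lists (h ` X). foldl \<delta>' q0 w \<in> F}"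
    then have v: "v \<in> map h ` lists X" "foldl \<delta>' q0 v \<in> F" by (simp_all add: lists_image)
    then obtain w where w: "w \<in> lists X" "v = map h w" by blast
    then have "w \<in> L" using v(2) fold[OF w(1)] unfolding L by simp
    with w(2) show "v \<in> map h ` L" by blast
  qed
  moreover have "\<forall>q\<in>Q. \<forall>y\<in>h ` X. \<delta>' q y \<in> Q" using A(4) assms(2) by (simp add: \<delta>'_def)
  ultimately show ?thesis
    unfolding regular_language_def
    by (intro exI[of _ Q] exI[of _ \<delta>'] exI[of _ q0] exI[of _ F] conjI A(1-3))
qed

lemma (in group) word_prod_append:
  assumes "u \<in> lists (carrier G)" "v \<in> lists (carrier G)"
  shows "word_prod G (u @ v) = word_prod G u \<otimes> word_prod G v"
proof -
  have "word_prod G w \<in> carrier G" if "w \<in> lists (carrier G)" for w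
    using that by (induction w) (auto simp: word_prod_def)
  with assms show ?thesis
    by (induction u) (auto simp: word_prod_def m_assoc)
qed

lemma word_prod_map:
  assumes "group_hom G H h" "w \<in> lists (carrier G)"
  shows "word_prod H (map h w) = h (word_prod G w)"
proof -
  interpret group_hom G H h by fact
  have "word_prod G w \<in> carrier G" if "w \<in> lists (carrier G)" for w
    using that by (induction w) (auto simp: word_prod_def)
  with assms(2) show ?thesis
    by (induction w) (auto simp: word_prod_def)
qed

lemma epiRegular_iso:
  assumes "epiRegular G" "group H" "h \<in> iso G H"
  shows "epiRegular H"
proof -
  have "group G" using assms(1) unfolding epiRegular_def by blast
  then interpret group_hom G H h
    using assms(2,3) by (simp add: group_hom_def group_hom_axioms_def iso_def)
  have inj: "inj_on h (carrier G)" and onto: "h ` carrier G = carrier H"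
    using assms(3) by (auto simp: iso_def bij_betw_def)
  obtain X L where X: "finite X" "generates_as_monoid G X" and L: "L \<subseteq> lists X" "regular_language X L"
    and avoid: "\<forall>w\<in>L. word_prod G w \<noteq> \<one>\<^bsub>G\<^esub>"
    and cover: "\<forall>g\<in>carrier G - {\<one>\<^bsub>G\<^esub>}. \<exists>w\<in>L. word_prod G w = g"
    using assms(1) unfolding epiRegular_def by blast
  have XG: "X \<subseteq> carrier G" using X(2) unfolding generates_as_monoid_def by blast
  have wp: "word_prod H (map h w) = h (word_prod G w)" if "w \<in> lists X" for w
    using that XG lists_mono[of X "carrier G"]
    by (intro word_prod_map[OF group_hom_axioms]) auto
  have closed: "word_prod G w \<in> carrier G" if "w \<in> lists X" for w
    using that XG by (induction w) (auto simp: word_prod_def)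
  have "generates_as_monoid H (h ` X)"
    unfolding generates_as_monoid_def
  proof (intro conjI ballI)
    show "h ` X \<subseteq> carrier H" using XG by auto
    fix y assume "y \<in> carrier H"
    then obtain g where g: "g \<in> carrier G" "y = h g" using onto by blast
    then obtain w where "w \<in> lists X" "word_prod G w = g"
      using X(2) unfolding generates_as_monoid_def by blast
    then show "\<exists>w\<in>lists (h ` X). word_prod H w = y"
      using wp g(2) by (intro bexI[of _ "map h w"]) (auto simp: lists_image)
  qed
  moreover have "regular_language (h ` X) (map h ` L)"
    using L(2) inj XG by (intro regular_language_map) (auto intro: inj_on_subset)
  moreover have "map h ` L \<subseteq> lists (h ` X)" using L(1) by (auto simp: lists_image)
  moreover have "\<forall>w\<in>map h ` L. word_prod H w \<noteq> \<one>\<^bsub>H\<^esub>"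
  proof
    fix w' assume "w' \<in> map h ` L"
    then obtain w where w: "w \<in> L" "w' = map h w" by blast
    then have "w \<in> lists X" using L(1) by blast
    with w avoid wp closed inj show "word_prod H w' \<noteq> \<one>\<^bsub>H\<^esub>"
      by (metis G.one_closed hom_one inj_onD)
  qed
  moreover have "\<forall>y\<in>carrier H - {\<one>\<^bsub>H\<^esub>}. \<exists>w\<in>map h ` L. word_prod H w = y"
  proof
    fix y assume y: "y \<in> carrier H - {\<one>\<^bsub>H\<^esub>}"
    then obtain g where g: "g \<in> carrier G" "y = h g" using onto by blast
    with y have "g \<noteq> \<one>\<^bsub>G\<^esub>" by auto
    with g cover obtain w where "w \<in> L" "word_prod G w = g" by blast
    then show "\<exists>w\<in>map h ` L. word_prod H w = y"
      using wp g(2) L(1) by (intro bexI[of _ "map h w"]) auto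
  qed
  ultimately show ?thesis
    unfolding epiRegular_def using assms(2) X(1) by blast
qed

section \<open>Hall's groups\<close>

type_synonym hall_elt = "int set \<times> bool \<times> int"

text \<open>
  A triple \<open>(c, e, n)\<close> stands for the normal form \<open>(\<Prod>i\<in>c. a\<^sub>i) z\<^sup>e t\<^sup>n\<close>, the lamps being multiplied in
  decreasing order of position. Multiplying two such products of lamps moves each lamp of the
  second past the smaller lamps of the first, and the parity below counts the factors \<open>z\<close> which
  that produces.
\<close>

definition twist :: "nat set \<Rightarrow> int set \<Rightarrow> int set \<Rightarrow> bool" where
  "twist A c d \<longleftrightarrow> odd (card {(i, j) \<in> c \<times> d. i < j \<and> nat (j - i) \<in> A})"

definition hall_group :: "nat set \<Rightarrow> hall_elt monoid" where
  "hall_group A =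
     \<lparr>carrier = {(c, e, n). finite c},
      mult = (\<lambda>(c, e, n) (d, f, m).
        (sym_diff c ((+) n ` d), (e \<noteq> f) \<noteq> twist A c ((+) n ` d), n + m)),
      one = ({}, False, 0)\<rparr>"

lemma carrier_hall [simp]: "(c, e, n) \<in> carrier (hall_group A) \<longleftrightarrow> finite c"
  and one_hall [simp]: "\<one>\<^bsub>hall_group A\<^esub> = ({}, False, 0)"
  and mult_hall: "(c, e, n) \<otimes>\<^bsub>hall_group A\<^esub> (d, f, m) =
    (sym_diff c ((+) n ` d), (e \<noteq> f) \<noteq> twist A c ((+) n ` d), n + m)"
  by (simp_all add: hall_group_def)

lemma odd_card_sym_diff:
  assumes "finite S" "finite T"
  shows "odd (card (sym_diff S T)) \<longleftrightarrow> odd (card S) \<noteq> odd (card T)"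
proof -
  have "card (sym_diff S T) = card (S - T) + card (T - S)"
    using assms by (intro card_Un_disjoint) auto
  moreover have "card S = card (S - T) + card (S \<inter> T)" "card T = card (T - S) + card (S \<inter> T)"
    using assms by (metis card_Diff_subset_Int card_mono finite_Int inf_le1 le_add_diff_inverse2 inf_commute)+
  ultimately show ?thesis by presburger
qed

lemma twist_empty [simp]: "\<not> twist A {} d" "\<not> twist A c {}"
  by (simp_all add: twist_def)

lemma twist_sym_diff_left:
  assumes "finite c" "finite c'" "finite d"
  shows "twist A (sym_diff c c') d \<longleftrightarrow> twist A c d \<noteq> twist A c' d"
proof -
  have *: "{(i, j) \<in> sym_diff c c' \<times> d. i < j \<and> nat (j - i) \<in> A} =
    sym_diff {(i, j) \<in> c \<times> d. i < j \<and> nat (j - i) \<in> A} {(i, j) \<in> c' \<times> d. i < j \<and> nat (j - i) \<in> A}"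
    by auto
  have fin: "finite {(i, j) \<in> c \<times> d. i < j \<and> nat (j - i) \<in> A}" if "finite c" for c
    using that assms(3) by (auto intro: finite_subset[of _ "c \<times> d"])
  show ?thesis
    unfolding twist_def * using assms by (intro odd_card_sym_diff fin)
qed

lemma twist_sym_diff_right:
  assumes "finite c" "finite d" "finite d'"
  shows "twist A c (sym_diff d d') \<longleftrightarrow> twist A c d \<noteq> twist A c d'"
proof -
  have *: "{(i, j) \<in> c \<times> sym_diff d d'. i < j \<and> nat (j - i) \<in> A} =
    sym_diff {(i, j) \<in> c \<times> d. i < j \<and> nat (j - i) \<in> A} {(i, j) \<in> c \<times> d'. i < j \<and> nat (j - i) \<in> A}"
    by auto
  have fin: "finite {(i, j) \<in> c \<times> d. i < j \<and> nat (j - i) \<in> A}" if "finite d" for d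
    using that assms(1) by (auto intro: finite_subset[of _ "c \<times> d"])
  show ?thesis
    unfolding twist_def * using assms by (intro odd_card_sym_diff fin)
qed

lemma twist_shift: "twist A ((+) n ` c) ((+) n ` d) \<longleftrightarrow> twist A c d"
proof -
  have "bij_betw (map_prod ((+) n) ((+) n)) {(i, j) \<in> c \<times> d. i < j \<and> nat (j - i) \<in> A}
      {(i, j) \<in> ((+) n ` c) \<times> ((+) n ` d). i < j \<and> nat (j - i) \<in> A}"
    by (rule bij_betw_byWitness[where f' = "map_prod ((+) (- n)) ((+) (- n))"]) auto
  from bij_betw_same_card[OF this] show ?thesis
    by (simp only: twist_def)
qed

lemma shift_sym_diff: "(+) n ` sym_diff c d = sym_diff ((+) n ` c) ((+) n ` d)" for n :: int
proof -
  have "inj ((+) n)" by simp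
  then show ?thesis by (simp only: image_Un image_set_diff)
qed

text \<open>
  Associativity is the cocycle identity for \<open>twist\<close>, which holds because \<open>twist\<close> is biadditive and
  invariant under simultaneous shifts.
\<close>

lemma group_hall: "group (hall_group A)"
proof (rule groupI)
  fix x y z
  assume carr: "x \<in> carrier (hall_group A)" "y \<in> carrier (hall_group A)" "z \<in> carrier (hall_group A)"
  obtain c e n d f m b g k where xyz: "x = (c, e, n)" "y = (d, f, m)" "z = (b, g, k)"
    by (metis prod_cases3)
  define d' where "d' = (+) n ` d"
  define b' where "b' = (+) n ` (+) m ` b"
  have fin: "finite c" "finite d'" "finite b'" using carr by (simp_all add: xyz d'_def b'_def)
  have shifts: "(+) (n + m) ` b = b'" "(+) n ` sym_diff d ((+) m ` b) = sym_diff d' b'"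
    by (simp_all only: b'_def d'_def shift_sym_diff) (simp add: image_image add.assoc)
  have tw: "twist A d ((+) m ` b) = twist A d' b'"
    by (simp only: b'_def d'_def twist_shift)
  have "sym_diff (sym_diff c d') b' = sym_diff c (sym_diff d' b')" by blast
  moreover have "(((e \<noteq> f) \<noteq> twist A c d') \<noteq> g) \<noteq> twist A (sym_diff c d') b' \<longleftrightarrow>
      (e \<noteq> ((f \<noteq> g) \<noteq> twist A d' b')) \<noteq> twist A c (sym_diff d' b')"
    unfolding twist_sym_diff_left[OF fin] twist_sym_diff_right[OF fin] by blast
  ultimately show "x \<otimes>\<^bsub>hall_group A\<^esub> y \<otimes>\<^bsub>hall_group A\<^esub> z = x \<otimes>\<^bsub>hall_group A\<^esub> (y \<otimes>\<^bsub>hall_group A\<^esub> z)"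
    unfolding xyz mult_hall shifts tw d'_def[symmetric] by (simp only: add.assoc)
next
  fix x assume "x \<in> carrier (hall_group A)"
  moreover obtain c e n where x: "x = (c, e, n)" by (metis prod_cases3)
  ultimately have "((+) (- n) ` c, e \<noteq> twist A c c, - n) \<in> carrier (hall_group A)" by auto
  moreover have "((+) (- n) ` c, e \<noteq> twist A c c, - n) \<otimes>\<^bsub>hall_group A\<^esub> x = \<one>\<^bsub>hall_group A\<^esub>"
    unfolding x mult_hall by (simp only: twist_shift) auto
  ultimately show "\<exists>y\<in>carrier (hall_group A). y \<otimes>\<^bsub>hall_group A\<^esub> x = \<one>\<^bsub>hall_group A\<^esub>" by blast
qed (auto simp: mult_hall)

lemma countable_carrier_hall: "countable (carrier (hall_group A))"
proof -
  have "carrier (hall_group A) = {c. finite c \<and> c \<subseteq> UNIV} \<times> UNIV"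
    by (auto simp: hall_group_def)
  then show ?thesis
    by (simp only:) (intro countable_SIGMA countable_Collect_finite_subset, auto)
qed

section \<open>A regular language that spells the nontrivial elements\<close>

definition lamp :: hall_elt where "lamp = ({0}, False, 0)"
definition central :: hall_elt where "central = ({}, True, 0)"
definition right :: hall_elt where "right = ({}, False, 1)"
definition left :: hall_elt where "left = ({}, False, - 1)"

lemmas letter_defs = lamp_def central_def right_def left_def

abbreviation letters :: "hall_elt set" where "letters \<equiv> {lamp, central, right, left}"

lemma distinct_letters [simp]:
  "lamp \<noteq> central" "lamp \<noteq> right" "lamp \<noteq> left" "central \<noteq> right" "central \<noteq> left" "right \<noteq> left"
  "central \<noteq> lamp" "right \<noteq> lamp" "left \<noteq> lamp" "right \<noteq> central" "left \<noteq> central" "left \<noteq> right"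
  by (auto simp: letter_defs)

lemma mult_letter:
  "(c, e, n) \<otimes>\<^bsub>hall_group A\<^esub> lamp = (sym_diff c {n}, e \<noteq> twist A c {n}, n)"
  "(c, e, n) \<otimes>\<^bsub>hall_group A\<^esub> central = (c, \<not> e, n)"
  "(c, e, n) \<otimes>\<^bsub>hall_group A\<^esub> right = (c, e, n + 1)"
  "(c, e, n) \<otimes>\<^bsub>hall_group A\<^esub> left = (c, e, n - 1)"
  by (auto simp: letter_defs mult_hall)

datatype phase = Start | Pos | Neg | Central | AtLamp | Beyond | Tail | Fail

instance phase :: finite
proof
  have "UNIV = {Start, Pos, Neg, Central, AtLamp, Beyond, Tail, Fail}"
    using phase.exhaust by blast
  then show "finite (UNIV :: phase set)" by (metis finite.emptyI finite_insert)
qed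

text \<open>
  In the phases \<open>Pos\<close> and \<open>Neg\<close> only a walk in one direction has been read, so the position is
  not the origin. In \<open>Central\<close> no lamp has been touched but the central coordinate is \<open>True\<close>, and no
  further letter \<open>central\<close> is admitted. The phases \<open>AtLamp\<close> and \<open>Beyond\<close> form the sweep to the right,
  which begins with the first lamp; a further lamp may be switched only in \<open>Beyond\<close>, that is, strictly
  to the right of the first one. In
  \<open>Tail\<close> no lamp may be switched at all.
\<close>

fun step_lamp :: "phase \<Rightarrow> phase" where
  "step_lamp Start = AtLamp"
| "step_lamp Pos = AtLamp"
| "step_lamp Neg = AtLamp"
| "step_lamp Beyond = AtLamp"
| "step_lamp _ = Fail"

fun step_central :: "phase \<Rightarrow> phase" where
  "step_central Central = Fail"
| "step_central Fail = Fail"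
| "step_central Start = Central"
| "step_central Pos = Central"
| "step_central Neg = Central"
| "step_central _ = Tail"

fun step_right :: "phase \<Rightarrow> phase" where
  "step_right Start = Pos"
| "step_right Neg = Fail"
| "step_right AtLamp = Beyond"
| "step_right q = q"

fun step_left :: "phase \<Rightarrow> phase" where
  "step_left Start = Neg"
| "step_left Pos = Fail"
| "step_left AtLamp = Tail"
| "step_left Beyond = Tail"
| "step_left q = q"

definition step :: "phase \<Rightarrow> hall_elt \<Rightarrow> phase" where
  "step q x = (if x = lamp then step_lamp q else if x = central then step_central q
     else if x = right then step_right q else step_left q)"

lemma step_simps [simp]:
  "step q lamp = step_lamp q" "step q central = step_central q"
  "step q right = step_right q" "step q left = step_left q"
  by (simp_all add: step_def)

text \<open>
  What the automaton knows about the value of the word read so far. The witness \<open>p\<close> is the position of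
  the first lit lamp: as long as the walker stays to its right, switching lamps cannot put it out.
  In every phase except \<open>Start\<close> and \<open>Fail\<close> this knowledge excludes the identity.
\<close>

fun certified :: "phase \<Rightarrow> hall_elt \<Rightarrow> bool" where
  "certified Start (c, e, n) \<longleftrightarrow> c = {} \<and> \<not> e \<and> n = 0"
| "certified Pos (c, e, n) \<longleftrightarrow> c = {} \<and> \<not> e \<and> n > 0"
| "certified Neg (c, e, n) \<longleftrightarrow> c = {} \<and> \<not> e \<and> n < 0"
| "certified Central (c, e, n) \<longleftrightarrow> c = {} \<and> e"
| "certified AtLamp (c, e, n) \<longleftrightarrow> (\<exists>p\<in>c. p \<le> n)"
| "certified Beyond (c, e, n) \<longleftrightarrow> (\<exists>p\<in>c. p < n)"
| "certified Tail (c, e, n) \<longleftrightarrow> c \<noteq> {}"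
| "certified Fail _ \<longleftrightarrow> True"

lemma certified_step:
  assumes "certified q g" "x \<in> letters"
  shows "certified (step q x) (g \<otimes>\<^bsub>hall_group A\<^esub> x)"
proof -
  obtain c e n where g: "g = (c, e, n)" by (metis prod_cases3)
  have lamp_Beyond: "\<exists>p\<in>sym_diff c {n}. p \<le> n" if "p \<in> c" "p < n" for p
    using that by (intro bexI[of _ p]) auto
  have "certified (step_lamp q) (sym_diff c {n}, e \<noteq> twist A c {n}, n)"
    using assms(1) lamp_Beyond unfolding g by (cases q) auto
  moreover have "certified (step_central q) (c, \<not> e, n)"
    using assms(1) unfolding g by (cases q) auto
  moreover have "certified (step_right q) (c, e, n + 1)"
    using assms(1) unfolding g by (cases q) (auto dest: less_imp_le)
  moreover have "certified (step_left q) (c, e, n - 1)"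
    using assms(1) unfolding g by (cases q) auto
  ultimately show ?thesis
    using assms(2) unfolding g by (elim insertE emptyE) (simp_all only: mult_letter step_simps)
qed

definition reach :: "nat set \<Rightarrow> phase \<Rightarrow> hall_elt \<Rightarrow> bool" where
  "reach A q g \<longleftrightarrow>
     (\<exists>w\<in>lists letters. foldl step Start w = q \<and> word_prod (hall_group A) w = g)"

lemma letters_carrier: "letters \<subseteq> carrier (hall_group A)"
  by (simp add: letter_defs)

lemma reach_start: "reach A Start ({}, False, 0)"
  unfolding reach_def by (intro bexI[of _ "[]"]) (auto simp: word_prod_def)

lemma word_prod_snoc:
  assumes "w \<in> lists letters" "x \<in> letters"
  shows "word_prod (hall_group A) (w @ [x]) = word_prod (hall_group A) w \<otimes>\<^bsub>hall_group A\<^esub> x"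
proof -
  interpret group "hall_group A" by (rule group_hall)
  have "x \<in> carrier (hall_group A)" "w \<in> lists (carrier (hall_group A))"
    using assms letters_carrier by blast+
  moreover from this have "word_prod (hall_group A) [x] = x"
    by (simp add: word_prod_def del: one_hall)
  ultimately show ?thesis
    using word_prod_append[of w "[x]"] by simp
qed

lemma reach_step:
  assumes "reach A q g" "x \<in> letters"
  shows "reach A (step q x) (g \<otimes>\<^bsub>hall_group A\<^esub> x)"
proof -
  obtain w where w: "w \<in> lists letters" "foldl step Start w = q" "word_prod (hall_group A) w = g"
    using assms(1) unfolding reach_def by blast
  have "w @ [x] \<in> lists letters" using w(1) assms(2) by simp
  moreover have "foldl step Start (w @ [x]) = step q x" using w(2) by simp
  moreover have "word_prod (hall_group A) (w @ [x]) = g \<otimes>\<^bsub>hall_group A\<^esub> x"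
    using word_prod_snoc[OF w(1) assms(2)] w(3) by simp
  ultimately show ?thesis unfolding reach_def by blast
qed

lemma reach_certified: "reach A q g \<Longrightarrow> certified q g"
proof -
  have "certified (foldl step Start w) (word_prod (hall_group A) w)" if "w \<in> lists letters" for w
    using that
  proof (induction w rule: rev_induct)
    case Nil
    then show ?case by (simp add: word_prod_def)
  next
    case (snoc x w)
    then have "w \<in> lists letters" "x \<in> letters" by auto
    then show ?case
      using certified_step snoc.IH word_prod_snoc by simp
  qed
  then show "reach A q g \<Longrightarrow> certified q g" unfolding reach_def by blast
qed

lemma reach_right:
  assumes "reach A q (c, e, n)" "step_right q = q" "n \<le> m"
  shows "reach A q (c, e, m)"
  using assms(3)
proof (induction m rule: int_ge_induct)
  case (step i)
  have "reach A (step q right) ((c, e, i) \<otimes>\<^bsub>hall_group A\<^esub> right)"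
    by (intro reach_step step.IH) simp
  then show ?case by (simp only: mult_letter step_simps assms(2))
qed (rule assms(1))

lemma reach_left:
  assumes "reach A q (c, e, n)" "step_left q = q" "m \<le> n"
  shows "reach A q (c, e, m)"
  using assms(3)
proof (induction m rule: int_le_induct)
  case (step i)
  have "reach A (step q left) ((c, e, i) \<otimes>\<^bsub>hall_group A\<^esub> left)"
    by (intro reach_step step.IH) simp
  then show ?case by (simp only: mult_letter step_simps assms(2))
qed (rule assms(1))

lemma reach_walk:
  assumes "reach A q (c, e, n)" "step_right q = q" "step_left q = q"
  shows "reach A q (c, e, m)"
  using reach_right[OF assms(1,2)] reach_left[OF assms(1,3)] linear[of n m] by blast

lemma reach_right_power:
  assumes "n > 0"
  shows "reach A Pos ({}, False, n)"
proof -
  have "reach A (step Start right) (({}, False, 0) \<otimes>\<^bsub>hall_group A\<^esub> right)"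
    by (intro reach_step reach_start) simp
  then have "reach A Pos ({}, False, 0 + 1)" by (simp only: mult_letter step_simps step_right.simps)
  then show ?thesis by (rule reach_right) (use assms in auto)
qed

lemma reach_left_power:
  assumes "n < 0"
  shows "reach A Neg ({}, False, n)"
proof -
  have "reach A (step Start left) (({}, False, 0) \<otimes>\<^bsub>hall_group A\<^esub> left)"
    by (intro reach_step reach_start) simp
  then have "reach A Neg ({}, False, 0 - 1)" by (simp only: mult_letter step_simps step_left.simps)
  then show ?thesis by (rule reach_left) (use assms in auto)
qed

lemma reach_central: "reach A Central ({}, True, n)"
proof -
  have "reach A (step Start central) (({}, False, 0) \<otimes>\<^bsub>hall_group A\<^esub> central)"
    by (intro reach_step reach_start) simp
  then have "reach A Central ({}, \<not> False, 0)"
    by (simp only: mult_letter step_simps step_central.simps)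
  then show ?thesis using reach_walk[of A Central "{}" True 0] by simp
qed

text \<open>
  Induction on the rightmost lamp: lighting the lamps in increasing order keeps the word inside the
  sweep. Nothing is claimed about the central coordinate, which depends on \<open>A\<close>; it is corrected
  only once the sweep is over.
\<close>

lemma reach_sweep:
  assumes "finite c" "c \<noteq> {}"
  shows "\<exists>e. reach A AtLamp (c, e, Max c)"
proof -
  have "c \<noteq> {} \<longrightarrow> (\<exists>e. reach A AtLamp (c, e, Max c))"
    using assms(1)
  proof (induction c rule: finite_linorder_max_induct)
    case (insert m c)
    have Max: "Max (insert m c) = m"
      using insert.hyps by (intro Max_eqI) auto
    have sd: "sym_diff c {m} = insert m c" using insert.hyps by auto
    have "\<exists>q e. reach A q (c, e, m) \<and> step_lamp q = AtLamp"
    proof (cases "c = {}")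
      case True
      then show ?thesis
        using reach_start reach_right_power[of m A] reach_left_power[of m A]
        by (metis linorder_neqE_linordered_idom step_lamp.simps(1-3))
    next
      case False
      then obtain e where "reach A AtLamp (c, e, Max c)" using insert.IH by blast
      then have "reach A Beyond (c, e, Max c + 1)"
        using reach_step[of A AtLamp _ right] by (force simp: mult_letter)
      moreover have "Max c + 1 \<le> m" using insert.hyps False by (simp add: zless_imp_add1_zle)
      ultimately have "reach A Beyond (c, e, m)" using reach_right[of A Beyond c e "Max c + 1" m] by simp
      then show ?thesis by (metis step_lamp.simps(4))
    qed
    then obtain q e where "reach A q (c, e, m)" "step_lamp q = AtLamp" by blast
    then have "reach A AtLamp (sym_diff c {m}, e \<noteq> twist A c {m}, m)"
      using reach_step[of A q "(c, e, m)" lamp] by (simp add: mult_letter)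
    then show ?case unfolding sd Max by blast
  qed simp
  with assms(2) show ?thesis by blast
qed

lemma reach_lit:
  assumes "finite c" "c \<noteq> {}"
  shows "reach A Tail (c, e, n)"
proof -
  obtain e' where "reach A AtLamp (c, e', Max c)" using reach_sweep assms by blast
  \<comment> \<open>One letter \<open>central\<close> is needed to enter \<open>Tail\<close>, and a second one undoes it when the central
    coordinate was right.\<close>
  then have 1: "reach A Tail (c, \<not> e', Max c)"
    using reach_step[of A AtLamp _ central] by (force simp: mult_letter)
  then have "reach A Tail (c, e', Max c)"
    using reach_step[of A Tail _ central] by (force simp: mult_letter)
  with 1 have "reach A Tail (c, e, Max c)" by (cases "e = e'") auto
  then show ?thesis by (rule reach_walk) auto
qed

lemma epiRegular_hall: "epiRegular (hall_group A)"
proof -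
  let ?G = "hall_group A"
  define L where "L = {w \<in> lists letters. foldl step Start w \<in> - {Start, Fail}}"
  have avoid: "word_prod ?G w \<noteq> \<one>\<^bsub>?G\<^esub>" if "w \<in> L" for w
  proof
    assume "word_prod ?G w = \<one>\<^bsub>?G\<^esub>"
    with that have "reach A (foldl step Start w) ({}, False, 0)"
      unfolding L_def reach_def by auto
    with that show False
      using reach_certified unfolding L_def by (cases "foldl step Start w") fastforce+
  qed
  have cover: "\<exists>w\<in>L. word_prod ?G w = g" if "g \<in> carrier ?G - {\<one>\<^bsub>?G\<^esub>}" for g
  proof -
    obtain c e n where g: "g = (c, e, n)" by (metis prod_cases3)
    with that have c: "finite c" "c \<noteq> {} \<or> e \<or> n \<noteq> 0" by auto
    have "\<exists>q. q \<in> - {Start, Fail} \<and> reach A q g"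
    proof (cases "c = {}")
      case True
      with c g show ?thesis
        using reach_central[of A n] reach_right_power[of n A] reach_left_power[of n A]
        by (cases e; cases "n > 0") force+
    next
      case False
      with c g show ?thesis using reach_lit[of c A e n] by blast
    qed
    then show ?thesis unfolding L_def reach_def by blast
  qed
  have "\<exists>w\<in>lists letters. word_prod ?G w = g" if "g \<in> carrier ?G" for g
  proof (cases "g = \<one>\<^bsub>?G\<^esub>")
    case True
    then show ?thesis by (intro bexI[of _ "[]"]) (auto simp: word_prod_def)
  next
    case False
    then show ?thesis using cover that unfolding L_def by blast
  qed
  then have "generates_as_monoid ?G letters"
    unfolding generates_as_monoid_def using letters_carrier by blast
  moreover have "regular_language letters L"
    unfolding L_def by (rule regular_languageI)
  moreover have "L \<subseteq> lists letters" "finite letters" unfolding L_def by auto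
  ultimately show ?thesis
    unfolding epiRegular_def using group_hall avoid cover
    by (intro conjI exI[of _ letters] exI[of _ L] ballI)
qed

section \<open>Isomorphism classes\<close>

definition noncommuting_shifts :: "('a, 'b) monoid_scheme \<Rightarrow> 'a \<times> 'a \<Rightarrow> nat set" where
  "noncommuting_shifts G = (\<lambda>(u, v). {n.
     let u' = v [^]\<^bsub>G\<^esub> n \<otimes>\<^bsub>G\<^esub> u \<otimes>\<^bsub>G\<^esub> inv\<^bsub>G\<^esub> (v [^]\<^bsub>G\<^esub> n) in u \<otimes>\<^bsub>G\<^esub> u' \<noteq> u' \<otimes>\<^bsub>G\<^esub> u})"

lemma noncommuting_shifts_iso:
  assumes "group G" "group H" "h \<in> iso G H" "u \<in> carrier G" "v \<in> carrier G"
  shows "noncommuting_shifts H (h u, h v) = noncommuting_shifts G (u, v)"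
proof -
  interpret group_hom G H h
    using assms(1-3) by (simp add: group_hom_def group_hom_axioms_def iso_def)
  have inj: "inj_on h (carrier G)" using assms(3) by (auto simp: iso_def bij_betw_def)
  define s where "s n = v [^]\<^bsub>G\<^esub> n \<otimes>\<^bsub>G\<^esub> u \<otimes>\<^bsub>G\<^esub> inv\<^bsub>G\<^esub> (v [^]\<^bsub>G\<^esub> n)" for n :: nat
  have s: "s n \<in> carrier G" for n using assms by (simp add: s_def)
  have hs: "h v [^]\<^bsub>H\<^esub> n \<otimes>\<^bsub>H\<^esub> h u \<otimes>\<^bsub>H\<^esub> inv\<^bsub>H\<^esub> (h v [^]\<^bsub>H\<^esub> n) = h (s n)" for n
    using assms by (simp add: s_def hom_nat_pow)
  have "h u \<otimes>\<^bsub>H\<^esub> h (s n) = h (s n) \<otimes>\<^bsub>H\<^esub> h u \<longleftrightarrow> u \<otimes>\<^bsub>G\<^esub> s n = s n \<otimes>\<^bsub>G\<^esub> u" for n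
    using inj_on_eq_iff[OF inj, of "u \<otimes>\<^bsub>G\<^esub> s n" "s n \<otimes>\<^bsub>G\<^esub> u"] s assms(4) by simp
  then show ?thesis
    unfolding noncommuting_shifts_def Let_def prod.case hs s_def[symmetric] by simp
qed

text \<open>
  The conjugate of \<open>a\<^sub>0\<close> by \<open>t\<^sup>n\<close> is \<open>a\<^sub>n\<close>, and \<open>a\<^sub>0 a\<^sub>n\<close> differs from \<open>a\<^sub>n a\<^sub>0\<close> by a factor \<open>z\<close> exactly if
  \<open>n \<in> A\<close>. For \<open>n = 0\<close> the two lamps coincide and commute, so membership of \<open>0\<close> is invisible.
\<close>

lemma noncommuting_shifts_hall:
  assumes "0 \<notin> A"
  shows "noncommuting_shifts (hall_group A) (lamp, right) = A"
proof -
  interpret group "hall_group A" by (rule group_hall)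
  have pow: "right [^]\<^bsub>hall_group A\<^esub> n = ({}, False, int n)" for n :: nat
    by (induction n) (auto simp: mult_letter)
  have inv: "inv\<^bsub>hall_group A\<^esub> ({}, False, int n) = ({}, False, - int n)" for n
    by (rule inv_equality) (auto simp: mult_hall)
  have pairs: "{(i, j). i = k \<and> j = l \<and> i < j \<and> nat (j - i) \<in> A} =
    (if k < l \<and> nat (l - k) \<in> A then {(k, l)} else {})" for k l :: int
    by auto
  have tw: "twist A {k} {l} \<longleftrightarrow> k < l \<and> nat (l - k) \<in> A" for k l
    by (simp add: twist_def pairs)
  have "{0} - {int n} \<union> ({int n} - {0}) = {int n} - {0} \<union> ({0} - {int n})" for n by auto
  then show ?thesis
    unfolding noncommuting_shifts_def using assms
    by (auto simp: pow inv lamp_def mult_hall tw Let_def intro: Suc_leI)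
      (metis gr0I)+
qed

text \<open>
  A group isomorphic to \<open>G\<^sub>A\<close> knows \<open>A\<close> up to the choice of two elements, the images of \<open>a\<^sub>0\<close> and \<open>t\<close>, and a
  countable group offers only countably many choices.
\<close>

lemma countable_hall_iso_class:
  assumes "group H" "countable (carrier H)"
  shows "countable {A. 0 \<notin> A \<and> hall_group A \<cong> H}"
proof -
  have "{A. 0 \<notin> A \<and> hall_group A \<cong> H} \<subseteq> noncommuting_shifts H ` (carrier H \<times> carrier H)"
  proof
    fix A assume "A \<in> {A. 0 \<notin> A \<and> hall_group A \<cong> H}"
    then obtain h where A: "0 \<notin> A" and h: "h \<in> iso (hall_group A) H"
      unfolding is_iso_def by blast
    have lr: "lamp \<in> carrier (hall_group A)" "right \<in> carrier (hall_group A)"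
      using letters_carrier by auto
    then have "A = noncommuting_shifts H (h lamp, h right)"
      using noncommuting_shifts_iso[OF group_hall assms(1) h] noncommuting_shifts_hall[OF A] by simp
    moreover have "(h lamp, h right) \<in> carrier H \<times> carrier H"
      using lr h by (auto simp: iso_def hom_def)
    ultimately show "A \<in> noncommuting_shifts H ` (carrier H \<times> carrier H)" by blast
  qed
  then show ?thesis
    using assms(2) by (meson countable_SIGMA countable_image countable_subset)
qed

text \<open>
  Countable classes cannot lower an uncountable cardinality: a set of representatives \<open>R\<close> must be
  infinite, and then \<open>|U| \<le> |R| \<cdot> \<aleph>\<^sub>0 = |R|\<close>.
\<close>

lemma eqpoll_transversal:
  includes cardinal_syntax
  assumes "equiv U r" "uncountable U" "\<And>x. x \<in> U \<Longrightarrow> countable (r `` {x})"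
  shows "\<exists>R\<subseteq>U. R \<approx> U \<and> pairwise (\<lambda>x y. (x, y) \<notin> r) R"
proof -
  define rep where "rep x = (SOME y. y \<in> r `` {x})" for x
  define R where "R = rep ` U"
  have rep: "(x, rep x) \<in> r" if "x \<in> U" for x
    using someI[of "\<lambda>y. y \<in> r `` {x}" x] equiv_class_self[OF assms(1) that] by (auto simp: rep_def)
  have R: "R \<subseteq> U"
    using rep assms(1) by (auto simp: R_def equiv_def refl_on_def)
  have U: "U = (\<Union>x\<in>R. r `` {x})"
  proof
    show "U \<subseteq> (\<Union>x\<in>R. r `` {x})"
      using rep assms(1) by (force simp: R_def equiv_def sym_def)
    show "(\<Union>x\<in>R. r `` {x}) \<subseteq> U"
      using assms(1) equiv_type by blast
  qed
  have "countable (r `` {x})" if "x \<in> R" for x using that R assms(3) by blast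
  then have "uncountable R" using assms(2) U by (metis countable_UN)
  then have inf: "infinite R" by (rule uncountable_infinite)
  have "|r `` {x}| \<le>o |R|" if "x \<in> R" for x
    using \<open>x \<in> R \<Longrightarrow> countable (r `` {x})\<close> that inf
    by (meson countable_card_of_nat infinite_iff_card_of_nat ordLeq_transitive)
  then have "|\<Union>x\<in>R. r `` {x}| \<le>o |R|"
    using inf card_of_refl[of R, THEN ordIso_imp_ordLeq] by (intro card_of_UNION_ordLeq_infinite) auto
  then have "|U| \<le>o |R|" by (subst U)
  then have "U \<lesssim> R"
    unfolding lepoll_def card_of_ordLeq[symmetric] .
  then have "R \<approx> U" using R by (simp add: lepoll_antisym subset_imp_lepoll)
  moreover have "pairwise (\<lambda>x y. (x, y) \<notin> r) R"
  proof (rule pairwiseI)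
    fix p q assume "p \<in> R" "q \<in> R" "p \<noteq> q"
    then obtain x y where xy: "x \<in> U" "y \<in> U" "p = rep x" "q = rep y" by (auto simp: R_def)
    show "(p, q) \<notin> r"
    proof
      assume "(p, q) \<in> r"
      then have "(x, y) \<in> r"
        using rep[OF xy(1)] rep[OF xy(2)] xy(3,4) assms(1) by (meson equivE symD transD)
      then have "r `` {x} = r `` {y}" using equiv_class_eq assms(1) by metis
      then have "p = q" using xy by (simp add: rep_def)
      with \<open>p \<noteq> q\<close> show False by blast
    qed
  qed
  ultimately show ?thesis using R by blast
qed

section \<open>The continuum of groups\<close>

text \<open>The successor keeps \<open>0\<close>, whose membership the group does not detect, out of the set.\<close>

definition cut :: "real \<Rightarrow> nat set" where
  "cut x = {Suc k |k. of_rat (from_nat k) < x}"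

lemma zero_notin_cut: "0 \<notin> cut x"
  by (simp add: cut_def)

lemma inj_cut: "inj cut"
proof (rule injI)
  have less: "cut x \<noteq> cut y" if "x < y" for x y
  proof -
    obtain q where "x < of_rat q" "of_rat q < y" using of_rat_dense[OF \<open>x < y\<close>] by blast
    then have "Suc (to_nat q) \<in> cut y" "Suc (to_nat q) \<notin> cut x" by (auto simp: cut_def)
    then show ?thesis by blast
  qed
  then show "x = y" if "cut x = cut y" for x y
    using that by (metis linorder_neqE_linordered_idom)
qed

lemma ex_nat_monoid_iso:
  assumes "group G" "countable (carrier G)"
  shows "\<exists>H :: nat monoid. group H \<and> G \<cong> H"
proof -
  interpret group G by fact
  define h where "h = to_nat_on (carrier G)"
  define k where "k = inv_into (carrier G) h"
  define H where "H = \<lparr>carrier = h ` carrier G, mult = (\<lambda>x y. h (k x \<otimes>\<^bsub>G\<^esub> k y)), one = h \<one>\<^bsub>G\<^esub>\<rparr>"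
  have inj: "inj_on h (carrier G)" using assms(2) by (simp add: h_def inj_on_to_nat_on)
  then have k: "k (h x) = x" if "x \<in> carrier G" for x using that by (simp add: k_def)
  have "group H"
  proof (rule groupI)
    show "\<exists>y\<in>carrier H. y \<otimes>\<^bsub>H\<^esub> x = \<one>\<^bsub>H\<^esub>" if "x \<in> carrier H" for x
      using that by (auto simp: H_def k intro!: bexI[of _ "inv\<^bsub>G\<^esub> k x"])
  qed (auto simp: H_def k m_assoc)
  moreover have "h \<in> iso G H"
    using inj by (auto simp: iso_def hom_def H_def bij_betw_def k)
  ultimately show ?thesis unfolding is_iso_def by blast
qed

theorem theoremG:
  shows "\<exists>S :: nat monoid set.
           S \<approx> (UNIV :: real set) \<and>
           (\<forall>G\<in>S. epiRegular G) \<and>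
           pairwise (\<lambda>G H. \<not> G \<cong> H) S"
proof -
  have "\<forall>x. \<exists>H :: nat monoid. group H \<and> hall_group (cut x) \<cong> H"
    by (rule allI, rule ex_nat_monoid_iso[OF group_hall countable_carrier_hall])
  from choice[OF this] obtain M :: "real \<Rightarrow> nat monoid"
    where all: "\<forall>x. group (M x) \<and> hall_group (cut x) \<cong> M x" ..
  then have M: "group (M x)" "hall_group (cut x) \<cong> M x" for x by simp_all
  have epi: "epiRegular (M x)" for x
  proof -
    obtain h where "h \<in> iso (hall_group (cut x)) (M x)"
      using M(2) unfolding is_iso_def by blast
    then show ?thesis by (rule epiRegular_iso[OF epiRegular_hall M(1)])
  qed
  define r where "r = {(x, y). M x \<cong> M y}"
  have "equiv UNIV r"
  proof (rule equivI)
    show "refl r" by (simp add: r_def refl_on_def)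
    show "sym r" unfolding r_def sym_def using group.iso_sym[OF M(1)] by blast
    show "trans r" unfolding r_def trans_def using iso_trans by blast
  qed simp
  moreover have "countable (r `` {x})" for x
  proof -
    have "cut ` (r `` {x}) \<subseteq> {A. 0 \<notin> A \<and> hall_group A \<cong> M x}"
    proof clarify
      fix y assume "(x, y) \<in> r"
      then have "M y \<cong> M x" using group.iso_sym[OF M(1)] by (simp add: r_def)
      then show "0 \<notin> cut y \<and> hall_group (cut y) \<cong> M x"
        using iso_trans[OF M(2)] zero_notin_cut by blast
    qed
    moreover have "countable (carrier (M x))" by simp
    ultimately have "countable (cut ` (r `` {x}))"
      using countable_hall_iso_class[OF M(1)] countable_subset by blast
    then show ?thesis
      using inj_cut by (meson countable_image_inj_on inj_on_subset subset_UNIV)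
  qed
  ultimately have "\<exists>R\<subseteq>UNIV. R \<approx> (UNIV :: real set) \<and> pairwise (\<lambda>x y. (x, y) \<notin> r) R"
    by (intro eqpoll_transversal uncountable_UNIV_real)
  then obtain R where R: "R \<approx> (UNIV :: real set)" "pairwise (\<lambda>x y. (x, y) \<notin> r) R"
    by blast
  have distinct: "\<not> M x \<cong> M y" if "x \<in> R" "y \<in> R" "x \<noteq> y" for x y
    using pairwiseD[OF R(2) that] by (simp add: r_def)
  have "inj_on M R"
  proof (rule inj_onI)
    fix x y assume xy: "x \<in> R" "y \<in> R" and "M x = M y"
    then have "M x \<cong> M y" by simp
    then show "x = y" using distinct[OF xy] by blast
  qed
  then have "M ` R \<approx> (UNIV :: real set)"
    by (rule eqpoll_trans[OF inj_on_image_eqpoll_self R(1)])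
  moreover have "pairwise (\<lambda>G H. \<not> G \<cong> H) (M ` R)"
  proof (rule pairwiseI)
    fix G H assume "G \<in> M ` R" "H \<in> M ` R" "G \<noteq> H"
    then obtain x y where "x \<in> R" "y \<in> R" "G = M x" "H = M y" "x \<noteq> y" by blast
    then show "\<not> G \<cong> H" using distinct by simp
  qed
  moreover have "\<forall>G\<in>M ` R. epiRegular G" using epi by simp
  ultimately show ?thesis by (intro exI[of _ "M ` R"] conjI)
qed

end
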